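(* Let $m\ge1$ be an integer. If $\delta_m\neq\delta_{m+1}$, then for every prime $p$, \[k_p=\begin{cases}k, & y_{m,k+1}<p\le y_{m,k}\ (k\ge1),\\ 0, & y_{m,1}<p.\end{cases}\] If instead $\delta_m=\delta_{m+1}$, where $(q_m,k_m)=(q,k)$ and $(q_{m+1},k_{m+1})=(q',k')$ with $q>q'$, then $k_q=k$ and $k_{q'}=k'-1$.
   Context: Consider all pairs $(q,k)$ with $q$ prime and $k\ge 1$ an integer, with value $z_{q,k}:=q+q^2+\cdots+q^k$. Enumerate these pairs as $(q_1,k_1),(q_2,k_2),\dots$ so that $z_i:=z_{q_i,k_i}$ is nondecreasing in $i$; if $z_{q,k}=z_{p,j}$ with $q>p$, then $(q,k)$ comes before $(p,j)$. Set $\delta_i:=\log(1+1/z_i)$. For $m\ge1$ let $E_m$ be the set of the first $m$ pairs; for each prime $p$ let $k_p$ be the largest $k$ with $(p,k)\in E_m$ ($k_p=0$ if none), and $n_m:=\prod_p p^{k_p}$. Define $y_{m,1}:=z_m$, and for $k\ge2$ let $y_{m,k}$ be the positive real solution of $y+y^2+\cdots+y^k=z_m$. *)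

theory Defs
  imports Complex_Main "HOL-Computational_Algebra.Primes" "HOL-Library.Infinite_Set"
begin

text \<open>Polymorphic, since it is used both for the value of a pair (natural numbers) and
  for the real equation defining the thresholds \<open>y_root\<close> below.\<close>

definition power_sum :: "'a::comm_semiring_1 \<Rightarrow> nat \<Rightarrow> 'a" where
  "power_sum x k = (\<Sum>i=1..k. x ^ i)"

definition prime_pairs :: "(nat \<times> nat) set" where
  "prime_pairs = {(q, k). prime q \<and> k \<ge> 1}"

definition pair_value :: "nat \<times> nat \<Rightarrow> nat" where
  "pair_value x = power_sum (fst x) (snd x)"

text \<open>Sequences are indexed from 1; the value \<open>e 0\<close> is irrelevant. The three clauses
  determine \<open>e\<close> on the positive integers, because distinct pairs of equal value have
  distinct primes.\<close>

definition pair_enumeration :: "(nat \<Rightarrow> nat \<times> nat) \<Rightarrow> bool" where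
  "pair_enumeration e \<longleftrightarrow>
     bij_betw e {1..} prime_pairs \<and>
     (\<forall>i j. 1 \<le> i \<longrightarrow> i \<le> j \<longrightarrow> pair_value (e i) \<le> pair_value (e j)) \<and>
     (\<forall>i j. 1 \<le> i \<longrightarrow> 1 \<le> j \<longrightarrow> pair_value (e i) = pair_value (e j) \<longrightarrow>
        fst (e i) > fst (e j) \<longrightarrow> i < j)"

definition z_seq :: "(nat \<Rightarrow> nat \<times> nat) \<Rightarrow> nat \<Rightarrow> nat" where
  "z_seq e i = pair_value (e i)"

definition delta_seq :: "(nat \<Rightarrow> nat \<times> nat) \<Rightarrow> nat \<Rightarrow> real" where
  "delta_seq e i = ln (1 + 1 / real (z_seq e i))"

definition first_pairs :: "(nat \<Rightarrow> nat \<times> nat) \<Rightarrow> nat \<Rightarrow> (nat \<times> nat) set" where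
  "first_pairs e m = e ` {1..m}"

definition prime_exponent :: "(nat \<Rightarrow> nat \<times> nat) \<Rightarrow> nat \<Rightarrow> nat \<Rightarrow> nat" where
  "prime_exponent e m p =
     (if \<exists>k. (p, k) \<in> first_pairs e m then Max {k. (p, k) \<in> first_pairs e m} else 0)"

definition y_root :: "(nat \<Rightarrow> nat \<times> nat) \<Rightarrow> nat \<Rightarrow> nat \<Rightarrow> real" where
  "y_root e m k =
     (if k = 1 then real (z_seq e m)
      else (THE y. y > 0 \<and> power_sum y k = real (z_seq e m)))"

text \<open>The remaining facts show that the enumeration exists and that the definite
  description in \<open>y_root\<close> is meaningful for \<open>k \<ge> 1\<close>.\<close>

lemma le_power_sum:
  fixes x :: "'a::linordered_semidom"
  assumes "x \<ge> 0" "k \<ge> 1"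
  shows "x \<le> power_sum x k"
proof -
  have "x ^ 1 \<le> (\<Sum>i=1..k. x ^ i)"
    by (rule member_le_sum) (use assms in auto)
  thus ?thesis by (simp add: power_sum_def)
qed

lemma power_sum_strict_mono_base:
  fixes x y :: "'a::linordered_semidom"
  assumes "0 \<le> x" "x < y" "k \<ge> 1"
  shows "power_sum x k < power_sum y k"
  unfolding power_sum_def
  by (rule sum_strict_mono) (use assms in \<open>auto intro!: power_strict_mono\<close>)

lemma power_sum_inj_exponent:
  fixes q :: nat
  assumes "q > 0" "power_sum q k = power_sum q l"
  shows "k = l"
proof -
  have "strict_mono (power_sum q)"
    using assms(1) by (simp add: strict_mono_Suc_iff power_sum_def)
  thus ?thesis using assms(2) by (simp add: strict_mono_eq)
qed

lemma ex1_power_sum_root: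
  fixes z :: real
  assumes "z > 0" "k \<ge> 1"
  shows "\<exists>!y. y > 0 \<and> power_sum y k = z"
proof -
  have cont: "continuous_on {0..z} (\<lambda>y. power_sum y k)"
    unfolding power_sum_def by (intro continuous_intros)
  have zero: "power_sum (0::real) k = 0"
    unfolding power_sum_def by (rule sum.neutral) auto
  have "power_sum 0 k \<le> z"
    using assms zero by simp
  moreover have "z \<le> power_sum z k"
    using assms by (intro le_power_sum) auto
  ultimately obtain y where y: "0 \<le> y" "power_sum y k = z"
    using IVT'[of "\<lambda>y. power_sum y k" 0 z z] cont assms by auto
  have "y \<noteq> 0" using y assms zero by auto
  show ?thesis
  proof (rule ex1I[of _ y])
    show "y > 0 \<and> power_sum y k = z" using y \<open>y \<noteq> 0\<close> by auto
    fix x assume "x > 0 \<and> power_sum x k = z"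
    thus "x = y"
      using y power_sum_strict_mono_base[of x y k] power_sum_strict_mono_base[of y x k] assms
      by (cases x y rule: linorder_cases) auto
  qed
qed

lemma pair_enumeration_exists: "\<exists>e. pair_enumeration e"
proof -
  define c where "c x = pair_value x * (pair_value x + 1) - fst x" for x
  have bnd: "1 \<le> fst x" "fst x \<le> pair_value x" if "x \<in> prime_pairs" for x
  proof -
    obtain q k where [simp]: "x = (q, k)" by (cases x)
    have "prime q" "k \<ge> 1" using that by (auto simp: prime_pairs_def)
    thus "1 \<le> fst x" "fst x \<le> pair_value x"
      using le_power_sum[of q k] prime_ge_1_nat[of q] by (auto simp: pair_value_def)
  qed
  have lt_val: "c x < c y"
    if "x \<in> prime_pairs" "y \<in> prime_pairs" "pair_value x < pair_value y" for x y
  proof -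
    have "pair_value x * (pair_value x + 1) \<le> pair_value y * pair_value y"
      using that(3) by (intro mult_mono) auto
    moreover have "c x < pair_value x * (pair_value x + 1)"
      using bnd[OF that(1)] unfolding c_def by (intro diff_less) auto
    moreover have "pair_value y * pair_value y \<le> c y"
      using bnd[OF that(2)] unfolding c_def by simp
    ultimately show ?thesis by linarith
  qed
  have lt_tie: "c x < c y"
    if "x \<in> prime_pairs" "y \<in> prime_pairs" "pair_value x = pair_value y" "fst x > fst y" for x y
  proof -
    have "fst x \<le> pair_value y * (pair_value y + 1)"
      using bnd[OF that(1)] that(3) by simp
    thus ?thesis using that(3,4) unfolding c_def by simp
  qed
  have inj: "inj_on c prime_pairs"
  proof (rule inj_onI)
    fix x y assume xy: "x \<in> prime_pairs" "y \<in> prime_pairs" "c x = c y"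
    have v: "pair_value x = pair_value y"
      using lt_val[of x y] lt_val[of y x] xy
      by (cases "pair_value x" "pair_value y" rule: linorder_cases) auto
    have f: "fst x = fst y"
      using lt_tie[of x y] lt_tie[of y x] xy v
      by (cases "fst x" "fst y" rule: linorder_cases) auto
    have "snd x = snd y"
      using v f bnd[OF xy(1)] power_sum_inj_exponent[of "fst x"] by (simp add: pair_value_def)
    thus "x = y" using f by (simp add: prod_eq_iff)
  qed
  have "(\<lambda>q. (q, 1)) ` {q::nat. prime q} \<subseteq> prime_pairs"
    by (auto simp: prime_pairs_def)
  hence "infinite prime_pairs"
    using primes_infinite finite_imageD[of "\<lambda>q. (q, 1::nat)" "{q::nat. prime q}"] finite_subset
    by (auto simp: inj_on_def)
  hence infi: "infinite (c ` prime_pairs)" using inj by (simp add: finite_image_iff)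
  define e where "e i = inv_into prime_pairs c (enumerate (c ` prime_pairs) (i - 1))" for i
  have "bij_betw (\<lambda>i. i - 1 :: nat) {1..} UNIV"
    by (rule bij_betw_byWitness[of _ Suc]) auto
  moreover have "bij_betw (inv_into prime_pairs c) (c ` prime_pairs) prime_pairs"
    using inj by (intro bij_betw_inv_into) (auto simp: bij_betw_def)
  ultimately have "bij_betw (inv_into prime_pairs c \<circ> (enumerate (c ` prime_pairs) \<circ> (\<lambda>i. i - 1)))
      {1..} prime_pairs"
    using bij_enumerate[OF infi] by (blast intro: bij_betw_trans)
  hence bij: "bij_betw e {1..} prime_pairs" unfolding e_def o_def .
  have ce: "c (e i) = enumerate (c ` prime_pairs) (i - 1)" for i
    unfolding e_def using enumerate_in_set[OF infi] by (rule f_inv_into_f)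
  have mem: "e i \<in> prime_pairs" if "1 \<le> i" for i
    using bij that by (auto simp: bij_betw_def)
  have mono: "c (e i) \<le> c (e j)" if "1 \<le> i" "i \<le> j" for i j
    using that infi unfolding ce by simp
  have "pair_value (e i) \<le> pair_value (e j)" if "1 \<le> i" "i \<le> j" for i j
  proof (rule ccontr)
    assume "\<not> ?thesis"
    hence "c (e j) < c (e i)" using that by (intro lt_val mem) auto
    thus False using mono[OF that] by simp
  qed
  moreover have "i < j"
    if "1 \<le> i" "1 \<le> j" "pair_value (e i) = pair_value (e j)" "fst (e i) > fst (e j)" for i j
  proof (rule ccontr)
    assume "\<not> i < j"
    hence "c (e j) \<le> c (e i)" using that by (intro mono) auto
    moreover have "c (e i) < c (e j)" using that by (intro lt_tie mem) auto
    ultimately show False by simp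
  qed
  ultimately have "pair_enumeration e" using bij unfolding pair_enumeration_def by blast
  thus ?thesis by blast
qed

end

theory Submission
  imports Defs
begin

text \<open>Membership in \<open>E\<^sub>m\<close> is decided by comparing values with \<open>z\<^sub>m\<close>, except for pairs of value
  exactly \<open>z\<^sub>m\<close>. If \<open>z\<^sub>m < z\<^sub>m\<^sub>+\<^sub>1\<close> these all belong to \<open>E\<^sub>m\<close>, so \<open>k\<^sub>p\<close> is the largest \<open>k\<close> with
  \<open>p + \<dots> + p\<^sup>k \<le> z\<^sub>m\<close>, which is the condition \<open>p \<le> y\<^sub>m\<^sub>,\<^sub>k\<close>. If \<open>z\<^sub>m = z\<^sub>m\<^sub>+\<^sub>1\<close>, then \<open>(q, k)\<close> and
  \<open>(q', k')\<close> are the only pairs over \<open>q\<close> and \<open>q'\<close> of that value; the first is in \<open>E\<^sub>m\<close>, the second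
  is not, and the tie-break rule gives \<open>q > q'\<close>.\<close>

lemma strict_mono_power_sum_exponent:
  fixes q :: nat
  assumes "q > 0"
  shows "strict_mono (power_sum q)"
  using assms by (simp add: strict_mono_Suc_iff power_sum_def)

text \<open>A strictly increasing map on the naturals dominates the identity. This bounds the
  exponents considered in \<open>ex_y_root_interval\<close>, so that a greatest one exists.\<close>

lemma exponent_le_power_sum:
  fixes q :: nat
  assumes "q > 0"
  shows "k \<le> power_sum q k"
  using strict_mono_power_sum_exponent[OF assms] by (rule strict_mono_imp_increasing)

lemma of_nat_power_sum: "of_nat (power_sum x k) = power_sum (of_nat x) k"
  by (simp add: power_sum_def)

lemma pair_value_pos:
  assumes "x \<in> prime_pairs"
  shows "pair_value x > 0"
  using assms le_power_sum[of "fst x" "snd x"] prime_gt_0_nat[of "fst x"]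
  by (auto simp: prime_pairs_def pair_value_def)

context
  fixes e :: "nat \<Rightarrow> nat \<times> nat"
  assumes enum: "pair_enumeration e"
begin

lemma enumeration_mem: "1 \<le> i \<Longrightarrow> e i \<in> prime_pairs"
  using enum by (auto simp: pair_enumeration_def bij_betw_def)

lemma enumeration_inj: "1 \<le> i \<Longrightarrow> 1 \<le> j \<Longrightarrow> e i = e j \<Longrightarrow> i = j"
  using enum by (auto simp: pair_enumeration_def bij_betw_def inj_on_def)

lemma enumeration_surj:
  assumes "x \<in> prime_pairs"
  obtains i where "1 \<le> i" "x = e i"
proof -
  have "x \<in> e ` {1..}"
    using enum assms by (simp add: pair_enumeration_def bij_betw_def)
  thus ?thesis using that by auto
qed

lemma z_seq_mono: "1 \<le> i \<Longrightarrow> i \<le> j \<Longrightarrow> z_seq e i \<le> z_seq e j"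
  using enum by (simp add: pair_enumeration_def z_seq_def)

lemma enumeration_tie:
  "1 \<le> i \<Longrightarrow> 1 \<le> j \<Longrightarrow> pair_value (e i) = pair_value (e j) \<Longrightarrow> fst (e i) > fst (e j) \<Longrightarrow> i < j"
  using enum by (simp add: pair_enumeration_def)

lemma z_seq_pos: "1 \<le> i \<Longrightarrow> z_seq e i > 0"
  using enumeration_mem pair_value_pos by (simp add: z_seq_def)

text \<open>\<open>ln\<close> is injective on the positive reals; this turns the theorem's case
  split on \<open>delta_seq\<close> into one on \<open>z_seq\<close>.\<close>

lemma delta_seq_eq_iff:
  assumes "1 \<le> i" "1 \<le> j"
  shows "delta_seq e i = delta_seq e j \<longleftrightarrow> z_seq e i = z_seq e j"
proof -
  have "1 + 1 / real (z_seq e i) > 0" "1 + 1 / real (z_seq e j) > 0"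
    by (simp_all add: add_pos_nonneg)
  thus ?thesis by (simp add: delta_seq_def)
qed

lemma first_pairs_subset: "first_pairs e m \<subseteq> prime_pairs"
  using enumeration_mem by (auto simp: first_pairs_def)

lemma enumeration_mem_first_pairs_iff:
  "1 \<le> i \<Longrightarrow> e i \<in> first_pairs e m \<longleftrightarrow> i \<le> m"
  using enumeration_inj by (force simp: first_pairs_def)

lemma first_pairs_value_le:
  assumes "x \<in> first_pairs e m"
  shows "pair_value x \<le> z_seq e m"
  using assms z_seq_mono by (auto simp: first_pairs_def z_seq_def)

text \<open>Comparing with the value at \<open>m + 1\<close> serves both cases: values equal to
  \<open>z_seq e m\<close> are covered when the next value is larger, and are left out in a
  tie.\<close>

lemma less_value_mem_first_pairs:
  assumes "x \<in> prime_pairs" "1 \<le> m" "pair_value x < z_seq e (m + 1)"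
  shows "x \<in> first_pairs e m"
proof -
  obtain i where i: "1 \<le> i" "x = e i"
    using assms(1) by (rule enumeration_surj)
  have "i \<le> m"
    using z_seq_mono[of "m + 1" i] assms(3) i(2) by (force simp: z_seq_def)
  thus ?thesis using i enumeration_mem_first_pairs_iff by simp
qed

text \<open>Prime pairs have no exponent 0, so the exponents of \<open>p\<close> in
  \<open>first_pairs e m\<close> form \<open>{1..k}\<close>. For \<open>k = 0\<close> this set is
  empty and \<open>prime_exponent\<close> takes its default value 0.\<close>

lemma prime_exponent_eqI:
  assumes "\<And>j. 1 \<le> j \<Longrightarrow> (p, j) \<in> first_pairs e m \<longleftrightarrow> j \<le> k"
  shows "prime_exponent e m p = k"
proof -
  have mem: "(p, j) \<in> first_pairs e m \<longleftrightarrow> j \<in> {1..k}" for j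
    using assms[of j] first_pairs_subset[of m] by (cases j) (auto simp: prime_pairs_def)
  hence "{j. (p, j) \<in> first_pairs e m} = {1..k}" by blast
  moreover have "(\<exists>j. (p, j) \<in> first_pairs e m) \<longleftrightarrow> k \<noteq> 0"
    unfolding mem by (auto intro: exI[of _ k])
  ultimately show ?thesis by (auto simp: prime_exponent_def intro!: Max_eqI)
qed

text \<open>For fixed \<open>k \<ge> 1\<close>, \<open>power_sum\<close> is strictly increasing on
  nonnegative reals, so real thresholds can be traded for inequalities between naturals.\<close>

lemma le_y_root_iff:
  assumes "1 \<le> m" "1 \<le> k"
  shows "real p \<le> y_root e m k \<longleftrightarrow> power_sum p k \<le> z_seq e m"
proof -
  define y where "y = y_root e m k"
  have "y > 0 \<and> power_sum y k = real (z_seq e m)"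
  proof (cases "k = 1")
    case True
    thus ?thesis using z_seq_pos[OF assms(1)] by (simp add: y_def y_root_def power_sum_def)
  next
    case False
    have "\<exists>!y. y > 0 \<and> power_sum y k = real (z_seq e m)"
      using z_seq_pos[OF assms(1)] assms(2) by (intro ex1_power_sum_root) auto
    from theI'[OF this] False show ?thesis by (simp add: y_def y_root_def)
  qed
  hence "real p \<le> y \<longleftrightarrow> power_sum (real p) k \<le> real (z_seq e m)"
    using power_sum_strict_mono_base[of "real p" y k] power_sum_strict_mono_base[of y "real p" k]
      assms(2)
    by (cases "real p" y rule: linorder_cases) auto
  thus ?thesis by (simp add: y_def flip: of_nat_power_sum)
qed

text \<open>The disjunct \<open>k = 0\<close> lets this also handle primes above
  \<open>y_root e m 1\<close>, where only the second inequality is at hand.\<close>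

lemma prime_exponent_no_tie:
  assumes "1 \<le> m" "z_seq e m < z_seq e (m + 1)" "prime p"
    and "k = 0 \<or> power_sum p k \<le> z_seq e m" "z_seq e m < power_sum p (Suc k)"
  shows "prime_exponent e m p = k"
proof (rule prime_exponent_eqI)
  fix j :: nat assume j: "1 \<le> j"
  have p: "p > 0" using assms(3) by (rule prime_gt_0_nat)
  \<comment> \<open>Pairs of value exactly \<open>z_seq e m\<close> are included because the next
    value is strictly larger.\<close>
  have "(p, j) \<in> first_pairs e m \<longleftrightarrow> power_sum p j \<le> z_seq e m"
    using first_pairs_value_le[of "(p, j)" m] less_value_mem_first_pairs[of "(p, j)" m] assms j
    by (auto simp: prime_pairs_def pair_value_def)
  also have "\<dots> \<longleftrightarrow> j \<le> k"
  proof
    assume "power_sum p j \<le> z_seq e m"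
    hence "power_sum p j < power_sum p (Suc k)" using assms(5) by simp
    thus "j \<le> k" using strict_mono_power_sum_exponent[OF p] by (simp add: strict_mono_less)
  next
    assume "j \<le> k"
    hence "power_sum p j \<le> power_sum p k"
      using strict_mono_power_sum_exponent[OF p] by (simp add: strict_mono_less_eq)
    thus "power_sum p j \<le> z_seq e m" using assms(4) j \<open>j \<le> k\<close> by auto
  qed
  finally show "(p, j) \<in> first_pairs e m \<longleftrightarrow> j \<le> k" .
qed

text \<open>Take the greatest \<open>k\<close> whose power sum is at most \<open>z_seq e m\<close>;
  maximality puts \<open>p\<close> above the next threshold.\<close>

lemma ex_y_root_interval:
  assumes "1 \<le> m" "prime p" "real p \<le> y_root e m 1"
  shows "\<exists>k\<ge>1. y_root e m (k + 1) < real p \<and> real p \<le> y_root e m k"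
proof -
  let ?P = "\<lambda>k. 1 \<le> k \<and> power_sum p k \<le> z_seq e m"
  define k where "k = Greatest ?P"
  have 1: "?P 1" using assms le_y_root_iff[of m 1 p] by simp
  have bound: "j \<le> z_seq e m" if "?P j" for j
    using that exponent_le_power_sum[OF prime_gt_0_nat[OF assms(2)], of j] by simp
  have k: "?P k"
    unfolding k_def using 1 bound by (intro GreatestI_nat[of ?P 1 "z_seq e m"]) auto
  have "\<not> ?P (k + 1)"
  proof
    assume "?P (k + 1)"
    hence "k + 1 \<le> k"
      unfolding k_def using bound by (intro Greatest_le_nat[of ?P _ "z_seq e m"]) auto
    thus False by simp
  qed
  thus ?thesis
    using k le_y_root_iff[of m k p] le_y_root_iff[of m "k + 1" p] assms(1)
    by (intro exI[of _ k]) auto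
qed

lemma prime_exponent_tie:
  assumes m: "1 \<le> m" and tie: "z_seq e m = z_seq e (m + 1)"
    and e: "e m = (q, k)" "e (m + 1) = (q', k')"
  shows "q > q'" "prime_exponent e m q = k" "prime_exponent e m q' = k' - 1"
proof -
  have pairs: "(q, k) \<in> prime_pairs" "(q', k') \<in> prime_pairs"
    using enumeration_mem[of m] enumeration_mem[of "m + 1"] m e by simp_all
  hence pos: "q > 0" "q' > 0" "k' \<ge> 1" by (auto simp: prime_pairs_def prime_gt_0_nat)
  have val: "z_seq e m = power_sum q k" "z_seq e m = power_sum q' k'"
    using tie e by (simp_all add: z_seq_def pair_value_def)
  \<comment> \<open>Over one prime, equal values force equal exponents, so a single pair would be
    listed twice.\<close>
  have ne: "q \<noteq> q'"
  proof
    assume "q = q'"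
    hence "e m = e (m + 1)" using power_sum_inj_exponent[OF pos(1)] val e by simp
    thus False using enumeration_inj[of m "m + 1"] m by simp
  qed
  \<comment> \<open>Otherwise the tie-break rule would place index \<open>m + 1\<close> before
    \<open>m\<close>.\<close>
  have "\<not> q < q'"
    using enumeration_tie[of "m + 1" m] m e tie by (auto simp: z_seq_def)
  with ne show "q > q'" by simp
  \<comment> \<open>By the tie, a value below \<open>z_seq e m\<close> is also below
    \<open>z_seq e (m + 1)\<close>. With \<open>above\<close>, only the exponent \<open>l\<close>
    itself is left open, and \<open>mem\<close> settles it for each prime.\<close>
  have below: "(p, j) \<in> first_pairs e m"
    if "(p, l) \<in> prime_pairs" "z_seq e m = power_sum p l" "1 \<le> j" "j < l" for p j l
    using that strict_mono_power_sum_exponent[of p] m tie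
    by (intro less_value_mem_first_pairs)
      (auto simp: prime_pairs_def pair_value_def prime_gt_0_nat strict_mono_less)
  have above: "(p, j) \<notin> first_pairs e m"
    if "p > 0" "z_seq e m = power_sum p l" "l < j" for p j l
    using that first_pairs_value_le[of "(p, j)" m] strict_mono_power_sum_exponent[of p]
    by (auto simp: pair_value_def strict_mono_less_eq)
  have mem: "(q, k) \<in> first_pairs e m" "(q', k') \<notin> first_pairs e m"
    using enumeration_mem_first_pairs_iff[of m m] enumeration_mem_first_pairs_iff[of "m + 1" m] m e
    by simp_all
  show "prime_exponent e m q = k"
  proof (rule prime_exponent_eqI)
    fix j :: nat assume "1 \<le> j"
    thus "(q, j) \<in> first_pairs e m \<longleftrightarrow> j \<le> k"
      using below[OF pairs(1) val(1), of j] above[OF pos(1) val(1), of j] mem(1)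
      by (cases j k rule: linorder_cases) auto
  qed
  \<comment> \<open>As \<open>k' \<ge> 1\<close>, the bound \<open>j \<le> k' - 1\<close> means
    \<open>j < k'\<close>; it is 0 when \<open>k' = 1\<close>.\<close>
  show "prime_exponent e m q' = k' - 1"
  proof (rule prime_exponent_eqI)
    fix j :: nat assume "1 \<le> j"
    thus "(q', j) \<in> first_pairs e m \<longleftrightarrow> j \<le> k' - 1"
      using below[OF pairs(2) val(2), of j] above[OF pos(2) val(2), of j] mem(2) pos(3)
      by (cases j k' rule: linorder_cases) auto
  qed
qed

end

theorem theorem2:
  fixes e :: "nat \<Rightarrow> nat \<times> nat" and m :: nat
  assumes "pair_enumeration e" and "m \<ge> 1"
  shows "(delta_seq e m \<noteq> delta_seq e (m + 1) \<longrightarrow>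
           (\<forall>p. prime p \<longrightarrow>
              ((\<exists>k\<ge>1. y_root e m (k + 1) < real p \<and> real p \<le> y_root e m k) \<or>
                y_root e m 1 < real p) \<and>
              (\<forall>k\<ge>1. y_root e m (k + 1) < real p \<and> real p \<le> y_root e m k \<longrightarrow>
                prime_exponent e m p = k) \<and>
              (y_root e m 1 < real p \<longrightarrow> prime_exponent e m p = 0))) \<and>
         (delta_seq e m = delta_seq e (m + 1) \<longrightarrow>
           (\<forall>q k q' k'. e m = (q, k) \<longrightarrow> e (m + 1) = (q', k') \<longrightarrow>
              q > q' \<and> prime_exponent e m q = k \<and> prime_exponent e m q' = k' - 1))"
proof (intro conjI impI allI)
  note enum = assms(1) and m = assms(2)
  {
    fix p :: nat
    assume delta: "delta_seq e m \<noteq> delta_seq e (m + 1)" and p: "prime p"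
    have z: "z_seq e m < z_seq e (m + 1)"
      using delta delta_seq_eq_iff[OF enum m, of "m + 1"] z_seq_mono[OF enum m, of "m + 1"]
      by (auto simp: le_less)
    show "(\<exists>k\<ge>1. y_root e m (k + 1) < real p \<and> real p \<le> y_root e m k) \<or> y_root e m 1 < real p"
      using ex_y_root_interval[OF enum m p] by fastforce
    show "prime_exponent e m p = k"
      if "1 \<le> k" "y_root e m (k + 1) < real p \<and> real p \<le> y_root e m k" for k
      using that le_y_root_iff[OF enum m, of k p] le_y_root_iff[OF enum m, of "k + 1" p]
      by (intro prime_exponent_no_tie[OF enum m z p]) auto
    show "prime_exponent e m p = 0" if "y_root e m 1 < real p"
      using that le_y_root_iff[OF enum m, of 1 p]
      by (intro prime_exponent_no_tie[OF enum m z p]) auto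
  }
  fix q k q' k'
  assume delta: "delta_seq e m = delta_seq e (m + 1)"
    and e: "e m = (q, k)" "e (m + 1) = (q', k')"
  have z: "z_seq e m = z_seq e (m + 1)"
    using delta delta_seq_eq_iff[OF enum m, of "m + 1"] by simp
  show "q > q'" "prime_exponent e m q = k" "prime_exponent e m q' = k' - 1"
    using prime_exponent_tie[OF enum m z e] .
qed

end
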